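(* Let $W$ be any right-angled Coxeter group. Then the Cayley graph $\mathrm{Cay}(W)$ has the strong hull property: for all $u,v,w\in W$, \[ |\mathrm{conv}(u,v)|\cdot|\mathrm{conv}(v,w)|\ \ge\ |\mathrm{conv}(u,v,w)|. \]
   Context: A Coxeter group $W$ with simple generators $S=\{s_1,\dots,s_r\}$ and Coxeter matrix $(m_{ij})$ (relations $s_i^2=1$, $(s_is_j)^{m_{ij}}=1$) is right-angled if every entry $m_{ij}$ lies in $\{1,2,\infty\}$ (possibly infinite group). $\mathrm{Cay}(W)$ is the undirected Cayley graph of $W$ with respect to $S$. For a connected graph $G$ with shortest-path distance $d$, a set $C\subseteq V(G)$ is convex if whenever $u,v\in C$ and $d(u,w)+d(w,v)=d(u,v)$ we have $w\in C$; $\mathrm{conv}(X)$ is the intersection of all convex sets containing $X$. *)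

theory Defs
  imports Main "HOL-Library.Extended_Nat" "HOL-Algebra.Generated_Groups"
begin

section \<open>Group presentations\<close>

text \<open>A letter \<open>(i, True)\<close> stands for the generator \<open>x\<^sub>i\<close>, and \<open>(i, False)\<close> for its
  formal inverse.\<close>

type_synonym 'i gword = "('i \<times> bool) list"

definition eval_gword :: "('g, 'b) monoid_scheme \<Rightarrow> ('i \<Rightarrow> 'g) \<Rightarrow> 'i gword \<Rightarrow> 'g" where
  "eval_gword G s w =
     foldr (\<lambda>(i, e) g. (if e then s i else inv\<^bsub>G\<^esub> s i) \<otimes>\<^bsub>G\<^esub> g) w \<one>\<^bsub>G\<^esub>"

text \<open>Equality of words in the free group on \<open>I\<close> modulo the normal closure of \<open>R\<close>.\<close>

inductive pres_equiv :: "'i set \<Rightarrow> 'i gword set \<Rightarrow> 'i gword \<Rightarrow> 'i gword \<Rightarrow> bool"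
  for I R where
  refl: "pres_equiv I R u u"
| sym: "pres_equiv I R u v \<Longrightarrow> pres_equiv I R v u"
| trans: "pres_equiv I R u v \<Longrightarrow> pres_equiv I R v w \<Longrightarrow> pres_equiv I R u w"
| cancel: "i \<in> I \<Longrightarrow> pres_equiv I R (u @ [(i, e), (i, \<not> e)] @ v) (u @ v)"
| relator: "r \<in> R \<Longrightarrow> pres_equiv I R (u @ r @ v) (u @ v)"

definition has_presentation ::
  "('g, 'b) monoid_scheme \<Rightarrow> 'i set \<Rightarrow> ('i \<Rightarrow> 'g) \<Rightarrow> 'i gword set \<Rightarrow> bool" where
  "has_presentation G I s R \<longleftrightarrow>
     group G \<and> s ` I \<subseteq> carrier G \<and> generate G (s ` I) = carrier G \<and>
     (\<forall>u \<in> lists (I \<times> UNIV). \<forall>v \<in> lists (I \<times> UNIV).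
        eval_gword G s u = eval_gword G s v \<longleftrightarrow> pres_equiv I R u v)"

section \<open>Coxeter groups\<close>

definition coxeter_matrix :: "nat \<Rightarrow> (nat \<Rightarrow> nat \<Rightarrow> enat) \<Rightarrow> bool" where
  "coxeter_matrix r m \<longleftrightarrow>
     (\<forall>i\<in>{1..r}. \<forall>j\<in>{1..r}.
        m i j = m j i \<and> m i i = 1 \<and> (i \<noteq> j \<longrightarrow> m i j \<ge> 2))"

text \<open>The case \<open>i = j\<close> gives the relators \<open>s\<^sub>i\<^sup>2\<close>, since the diagonal entries are \<open>1\<close>;
  entries \<open>\<infinity>\<close> contribute no relator.\<close>

definition coxeter_relators :: "nat \<Rightarrow> (nat \<Rightarrow> nat \<Rightarrow> enat) \<Rightarrow> nat gword set" where
  "coxeter_relators r m =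
     {concat (replicate k [(i, True), (j, True)]) | i j k.
        i \<in> {1..r} \<and> j \<in> {1..r} \<and> m i j = enat k}"

definition coxeter_system ::
  "('g, 'b) monoid_scheme \<Rightarrow> nat \<Rightarrow> (nat \<Rightarrow> 'g) \<Rightarrow> (nat \<Rightarrow> nat \<Rightarrow> enat) \<Rightarrow> bool" where
  "coxeter_system W r s m \<longleftrightarrow>
     coxeter_matrix r m \<and> has_presentation W {1..r} s (coxeter_relators r m)"

definition right_angled :: "nat \<Rightarrow> (nat \<Rightarrow> nat \<Rightarrow> enat) \<Rightarrow> bool" where
  "right_angled r m \<longleftrightarrow> (\<forall>i\<in>{1..r}. \<forall>j\<in>{1..r}. m i j \<in> {1, 2, \<infinity>})"

section \<open>Graphs, convexity and the strong hull property\<close>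

text \<open>An undirected graph is given by its vertex set \<open>V\<close> and its symmetric adjacency relation
  \<open>E \<subseteq> V \<times> V\<close>. The distance is meaningful only between vertices joined by some walk, which is
  always the case in a connected graph.\<close>

definition graph_dist :: "('a \<times> 'a) set \<Rightarrow> 'a \<Rightarrow> 'a \<Rightarrow> nat" where
  "graph_dist E u v = (LEAST n. (u, v) \<in> E ^^ n)"

definition graph_convex :: "'a set \<Rightarrow> ('a \<times> 'a) set \<Rightarrow> 'a set \<Rightarrow> bool" where
  "graph_convex V E C \<longleftrightarrow>
     C \<subseteq> V \<and>
     (\<forall>u\<in>C. \<forall>v\<in>C. \<forall>w\<in>V.
        graph_dist E u w + graph_dist E w v = graph_dist E u v \<longrightarrow> w \<in> C)"

definition graph_hull :: "'a set \<Rightarrow> ('a \<times> 'a) set \<Rightarrow> 'a set \<Rightarrow> 'a set" where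
  "graph_hull V E X = \<Inter>{C. graph_convex V E C \<and> X \<subseteq> C}"

text \<open>The inequality is one of cardinal numbers, so that it has its intended meaning whether or
  not the hulls are finite (\<^const>\<open>card\<close> is \<open>0\<close> on infinite sets).\<close>

context
  includes cardinal_syntax
begin

definition strong_hull_property :: "'a set \<Rightarrow> ('a \<times> 'a) set \<Rightarrow> bool" where
  "strong_hull_property V E \<longleftrightarrow>
     (\<forall>u\<in>V. \<forall>v\<in>V. \<forall>w\<in>V.
        |graph_hull V E {u, v, w}| \<le>o |graph_hull V E {u, v}| *c |graph_hull V E {v, w}| )"

end

definition cayley_edges ::
  "('g, 'b) monoid_scheme \<Rightarrow> 'i set \<Rightarrow> ('i \<Rightarrow> 'g) \<Rightarrow> ('g \<times> 'g) set" where
  "cayley_edges G I s =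
     {(x, y). x \<in> carrier G \<and> y \<in> carrier G \<and>
        (\<exists>i\<in>I. y = x \<otimes>\<^bsub>G\<^esub> s i \<or> x = y \<otimes>\<^bsub>G\<^esub> s i)}"

end

theory Submission
  imports Defs
begin

text \<open>The Cayley graph of a right-angled Coxeter group is a median graph, and the inequality holds
  in every median graph whose points are separated by complementary convex sets: the map sending
  \<open>x\<close> to the medians of \<open>x, u, v\<close> and of \<open>x, v, w\<close> is injective on \<open>conv(u, v, w)\<close>, because two
  points of this hull are separated by a half-space that also separates \<open>u\<close> from \<open>v\<close> or \<open>v\<close> from
  \<open>w\<close>, and the corresponding median lies on the same side as \<open>x\<close>.

  Half-spaces come from the set \<open>N(g)\<close> of reflections that occur an odd number of times in a word
  for \<open>g\<close>. It satisfies the cocycle identity \<open>N(gh) = N(g) \<triangle> g N(h) g\<^sup>-\<^sup>1\<close>, so that \<open>d(u, v)\<close> is the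
  size of \<open>N(u) \<triangle> N(v)\<close>. Medians come from the quadrangle condition: two distinct descents of an
  element commute.\<close>

section \<open>Median graphs\<close>

lemma strong_hull_property_if_medians:
  assumes median: "\<And>x u v. x \<in> V \<Longrightarrow> u \<in> V \<Longrightarrow> v \<in> V \<Longrightarrow>
      \<exists>p\<in>V. graph_dist E x p + graph_dist E p u = graph_dist E x u \<and>
        graph_dist E x p + graph_dist E p v = graph_dist E x v \<and>
        graph_dist E u p + graph_dist E p v = graph_dist E u v"
    and separated: "\<And>x y. x \<in> V \<Longrightarrow> y \<in> V \<Longrightarrow> x \<noteq> y \<Longrightarrow>
      \<exists>H. graph_convex V E H \<and> graph_convex V E (V - H) \<and> x \<in> H \<and> y \<notin> H"
  shows "strong_hull_property V E"
proof -
  let ?d = "graph_dist E"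
  obtain med where med: "\<And>x u v. x \<in> V \<Longrightarrow> u \<in> V \<Longrightarrow> v \<in> V \<Longrightarrow>
      med x u v \<in> V \<and> ?d x (med x u v) + ?d (med x u v) u = ?d x u \<and>
        ?d x (med x u v) + ?d (med x u v) v = ?d x v \<and>
        ?d u (med x u v) + ?d (med x u v) v = ?d u v"
    using median by metis
  have convD: "q \<in> C" if "graph_convex V E C" "a \<in> C" "b \<in> C" "q \<in> V" "?d a q + ?d q b = ?d a b"
    for C a b q
    using that unfolding graph_convex_def by blast
  have hull_sub: "graph_hull V E X \<subseteq> C" if "graph_convex V E C" "X \<subseteq> C" for X C
    using that unfolding graph_hull_def by blast
  have V_convex: "graph_convex V E V"
    by (simp add: graph_convex_def)
  have med_hull: "med x u v \<in> graph_hull V E {u, v}" if "x \<in> V" "u \<in> V" "v \<in> V" for x u v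
    using med[OF that] convD unfolding graph_hull_def by blast
  \<comment> \<open>If \<open>H\<close> separated \<open>u\<close> from \<open>v\<close>, the common
    median would lie between \<open>x\<close> and the end on its side, hence in \<open>H\<close>,
    and between \<open>y\<close> and the other end, hence outside \<open>H\<close>.\<close>
  have same_side: "\<not> (u \<in> H \<and> v \<notin> H) \<and> \<not> (v \<in> H \<and> u \<notin> H)"
    if H: "graph_convex V E H" "graph_convex V E (V - H)" "x \<in> H" "y \<notin> H"
      and V: "x \<in> V" "y \<in> V" "u \<in> V" "v \<in> V" and eq: "med x u v = med y u v"
    for H x y u v
    using med[OF V(1,3,4)] med[OF V(2,3,4)] eq H V
      convD[OF H(1), of x u "med x u v"] convD[OF H(1), of x v "med x u v"]
      convD[OF H(2), of y u "med x u v"] convD[OF H(2), of y v "med x u v"]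
    by auto
  include cardinal_syntax
  have "|graph_hull V E {u, v, w}| \<le>o |graph_hull V E {u, v}| *c |graph_hull V E {v, w}|"
    if V: "u \<in> V" "v \<in> V" "w \<in> V" for u v w
  proof -
    let ?X = "graph_hull V E {u, v, w}"
    let ?f = "\<lambda>x. (med x u v, med x v w)"
    have XV: "?X \<subseteq> V"
      using hull_sub[OF V_convex] V by simp
    have "inj_on ?f ?X"
    proof (rule inj_onI, rule ccontr)
      fix x y
      assume xy: "x \<in> ?X" "y \<in> ?X" "?f x = ?f y" "x \<noteq> y"
      then obtain H where H: "graph_convex V E H" "graph_convex V E (V - H)" "x \<in> H" "y \<notin> H"
        using separated XV by blast
      \<comment> \<open>Otherwise the whole hull, hence both \<open>x\<close> and \<open>y\<close>,
        would lie on one side of \<open>H\<close>.\<close>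
      have "\<not> {u, v, w} \<subseteq> H" "\<not> {u, v, w} \<subseteq> V - H"
        using hull_sub[OF H(1)] hull_sub[OF H(2)] H xy by blast+
      moreover have "\<not> (u \<in> H \<and> v \<notin> H) \<and> \<not> (v \<in> H \<and> u \<notin> H)"
        "\<not> (v \<in> H \<and> w \<notin> H) \<and> \<not> (w \<in> H \<and> v \<notin> H)"
        using same_side[OF H] xy XV V by auto
      ultimately show False
        using V by blast
    qed
    moreover have "?f ` ?X \<subseteq> graph_hull V E {u, v} \<times> graph_hull V E {v, w}"
      using med_hull V XV by blast
    ultimately have "\<exists>f. inj_on f ?X \<and> f ` ?X \<subseteq> graph_hull V E {u, v} \<times> graph_hull V E {v, w}"
      by (intro exI[of _ ?f] conjI)
    \<comment> \<open>\<open>*c\<close> unfolds to the cardinality of a product set, so an injection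
      into that product suffices, for infinite hulls too.\<close>
    then show ?thesis
      unfolding BNF_Cardinal_Arithmetic.cprod_def Field_card_of by (rule card_of_ordLeq[THEN iffD1])
  qed
  then show ?thesis
    unfolding strong_hull_property_def by blast
qed

text \<open>Induction along a geodesic from \<open>v\<close> to \<open>w\<close>: the quadrangle condition removes every local
  maximum of the distance to \<open>x\<close>, and the bottom of the resulting valley is a median.\<close>

lemma median_if_quadrangle:
  fixes d :: "'a \<Rightarrow> 'a \<Rightarrow> nat"
  assumes zero: "\<And>x y. x \<in> V \<Longrightarrow> y \<in> V \<Longrightarrow> d x y = 0 \<longleftrightarrow> x = y"
    and sym: "\<And>x y. x \<in> V \<Longrightarrow> y \<in> V \<Longrightarrow> d x y = d y x"
    and tri: "\<And>x y z. x \<in> V \<Longrightarrow> y \<in> V \<Longrightarrow> z \<in> V \<Longrightarrow> d x z \<le> d x y + d y z"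
    and step: "\<And>x y n. x \<in> V \<Longrightarrow> y \<in> V \<Longrightarrow> d x y = Suc n \<Longrightarrow> \<exists>z\<in>V. d x z = 1 \<and> d z y = n"
    and bip: "\<And>x y z. x \<in> V \<Longrightarrow> y \<in> V \<Longrightarrow> z \<in> V \<Longrightarrow> d x y = 1 \<Longrightarrow> d z x \<noteq> d z y"
    and quad: "\<And>x g p q. x \<in> V \<Longrightarrow> g \<in> V \<Longrightarrow> p \<in> V \<Longrightarrow> q \<in> V \<Longrightarrow> p \<noteq> q \<Longrightarrow>
      d g p = 1 \<Longrightarrow> d g q = 1 \<Longrightarrow> d x p < d x g \<Longrightarrow> d x q < d x g \<Longrightarrow>
      \<exists>h\<in>V. d h p = 1 \<and> d h q = 1 \<and> d x h + 2 = d x g"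
    and V: "x \<in> V" "v \<in> V" "w \<in> V"
  shows "\<exists>m\<in>V. d x m + d m v = d x v \<and> d x m + d m w = d x w \<and> d v m + d m w = d v w"
  using V(2)
proof (induction "d v w" arbitrary: v)
  case 0
  then have "v = w"
    using zero V by metis
  then show ?case
    using zero V by (intro bexI[of _ w]) auto
next
  case (Suc n)
  \<comment> \<open>Moving to a neighbour \<open>v'\<close> nearer to both \<open>x\<close> and
    \<open>w\<close> is harmless: a median of \<open>x\<close>, \<open>v'\<close>, \<open>w\<close>
    is also one of \<open>x\<close>, \<open>v\<close>, \<open>w\<close>.\<close>
  have down: ?case if v': "v' \<in> V" "d v v' = 1" "d v' w = n" "d x v' < d x v" for v'
  proof -
    obtain m where m: "m \<in> V" "d x m + d m v' = d x v'" "d x m + d m w = d x w"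
      "d v' m + d m w = n"
      using Suc.hyps(1)[OF v'(3)[symmetric] v'(1)] v' by auto
    have "d x v \<le> d x m + d m v" "d m v \<le> d m v' + d v' v" "d v w \<le> d v m + d m w"
      using tri V m(1) v'(1) Suc.prems by blast+
    moreover have "d v' v = 1" "d v m = d m v" "d v' m = d m v'" "d x v \<le> d x v' + d v' v"
      using sym[OF v'(1) Suc.prems] sym[OF Suc.prems m(1)] sym[OF v'(1) m(1)] v'(2)
        tri[OF V(1) v'(1) Suc.prems] by simp_all
    ultimately show ?thesis
      using m v'(3,4) Suc.hyps(2) by (intro bexI[of _ m]) linarith+
  qed
  obtain v1 where v1: "v1 \<in> V" "d v v1 = 1" "d v1 w = n"
    using step[OF Suc.prems V(3)] Suc.hyps(2) by metis
  show ?case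
  proof (cases "d x v1 < d x v")
    case True
    then show ?thesis
      using down v1 by blast
  next
    case False
    then have lt: "d x v < d x v1"
      using bip[OF Suc.prems v1(1) V(1) v1(2)] by simp
    have up: "d x v1 = Suc (d x v)"
      using lt tri[OF V(1) Suc.prems v1(1)] v1(2) by simp
    obtain m where m: "m \<in> V" "d x m + d m v1 = d x v1" "d x m + d m w = d x w"
      "d v1 m + d m w = n"
      using Suc.hyps(1)[OF v1(3)[symmetric] v1(1)] v1 by auto
    show ?thesis
    proof (cases "d v1 m")
      \<comment> \<open>Here \<open>v1\<close> lies between \<open>x\<close> and \<open>w\<close>.
        Since \<open>v\<close> is one step nearer to \<open>x\<close> and one step farther from
        \<open>w\<close>, it lies between them too and is the median.\<close>
      case 0
      then have "v1 = m"
        using zero v1 m by metis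
      then have "d x v1 + n = d x w"
        using m v1 by simp
      then have "d x v + d v w = d x w"
        using up Suc.hyps(2) by simp
      then show ?thesis
        using zero[OF Suc.prems Suc.prems] Suc.prems by (intro bexI[of _ v]) auto
    next
      case (Suc k)
      \<comment> \<open>The next vertex towards \<open>m\<close> approaches \<open>x\<close> and
        \<open>w\<close> at once, because \<open>m\<close> lies between \<open>v1\<close> and each
        of them.\<close>
      then obtain q where q: "q \<in> V" "d v1 q = 1" "d q m = k"
        using step[OF v1(1) m(1)] by blast
      have "d x q \<le> d x m + d m q" "d q w \<le> d q m + d m w"
        using tri V q m by blast+
      then have q2: "d x q < d x v1" "d q w < n"
        using m Suc q sym[OF m(1) v1(1)] sym[OF m(1) q(1)] by auto
      then have "v \<noteq> q"
        using Suc.hyps(2) by auto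
      \<comment> \<open>Both \<open>v\<close> and \<open>q\<close> are neighbours of
        \<open>v1\<close> nearer to \<open>x\<close>. The fourth corner \<open>h\<close> is nearer
        to \<open>x\<close> than \<open>v\<close> and turns out to be at distance \<open>n\<close>
        from \<open>w\<close>, so \<open>down\<close> applies to it.\<close>
      then obtain h where h: "h \<in> V" "d h v = 1" "d h q = 1" "d x h + 2 = d x v1"
        using quad[OF V(1) v1(1) Suc.prems q(1)] q2 q lt v1 sym[OF v1(1) Suc.prems] by auto
      have "d h w \<le> d h q + d q w" "d v w \<le> d v h + d h w"
        using tri V q h Suc.prems by blast+
      then have "d h w = n"
        using h q2 Suc.hyps(2) sym[OF h(1) Suc.prems] by auto
      then show ?thesis
        using down[OF h(1)] h up sym[OF h(1) Suc.prems] by auto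
    qed
  qed
qed

section \<open>Groups generated by involutions with a reflection cocycle\<close>

lemma (in group) eval_gword_generate:
  assumes "s ` I \<subseteq> carrier G" and "g \<in> generate G (s ` I)"
  shows "\<exists>w\<in>lists (I \<times> UNIV). eval_gword G s w = g"
  using assms(2)
proof induction
  case one
  show ?case by (intro bexI[of _ "[]"]) (auto simp: eval_gword_def)
next
  case (incl h)
  then obtain i where "i \<in> I" "h = s i" by blast
  then show ?case
    using assms(1) by (intro bexI[of _ "[(i, True)]"]) (auto simp: eval_gword_def)
next
  case (inv h)
  then obtain i where "i \<in> I" "h = s i" by blast
  then show ?case
    using assms(1) by (intro bexI[of _ "[(i, False)]"]) (auto simp: eval_gword_def)
next
  case (eng h1 h2)
  then obtain u v where uv: "u \<in> lists (I \<times> UNIV)" "eval_gword G s u = h1"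
    "v \<in> lists (I \<times> UNIV)" "eval_gword G s v = h2"
    by blast
  have closed: "eval_gword G s w \<in> carrier G" if "w \<in> lists (I \<times> UNIV)" for w
    using that assms(1) by (induction w) (auto simp: eval_gword_def)
  have "eval_gword G s (w @ v) = eval_gword G s w \<otimes> eval_gword G s v"
    if "w \<in> lists (I \<times> UNIV)" for w
    using that
  proof (induction w)
    case Nil
    then show ?case using closed[OF uv(3)] by (simp add: eval_gword_def)
  next
    case (Cons x w)
    then have "fst x \<in> I" "eval_gword G s w \<in> carrier G"
      using closed by auto
    then show ?case
      using Cons closed[OF uv(3)] assms(1)
      by (cases x) (auto simp: eval_gword_def m_assoc image_subset_iff)
  qed
  then show ?case
    using uv by (intro bexI[of _ "u @ v"]) auto
qed

text \<open>\<open>N g\<close> plays the role of the set of walls separating \<open>\<one>\<close> from \<open>g\<close>, a wall being represented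
  by its reflection.\<close>

locale reflection_cocycle = group G for G (structure) +
  fixes I :: "'i set" and s :: "'i \<Rightarrow> 'a" and N :: "'a \<Rightarrow> 'a set"
  assumes s_closed [simp]: "i \<in> I \<Longrightarrow> s i \<in> carrier G"
    and generated: "generate G (s ` I) = carrier G"
    and s_square [simp]: "i \<in> I \<Longrightarrow> s i \<otimes> s i = \<one>"
    and N_closed: "g \<in> carrier G \<Longrightarrow> N g \<subseteq> carrier G"
    and N_one [simp]: "N \<one> = {}"
    and N_step: "i \<in> I \<Longrightarrow> h \<in> carrier G \<Longrightarrow> t \<in> carrier G \<Longrightarrow>
      t \<in> N (s i \<otimes> h) \<longleftrightarrow> (t = s i) \<noteq> (s i \<otimes> t \<otimes> s i \<in> N h)"
begin

lemma inv_s [simp]: "i \<in> I \<Longrightarrow> inv (s i) = s i"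
  by (simp add: inv_equality)

lemma s_cancel [simp]: "i \<in> I \<Longrightarrow> g \<in> carrier G \<Longrightarrow> s i \<otimes> (s i \<otimes> g) = g"
  by (simp flip: m_assoc)

text \<open>Letters carry no sign because the generators are involutions.\<close>

definition word :: "'i list \<Rightarrow> 'a" where
  "word ws = foldr (\<lambda>i g. s i \<otimes> g) ws \<one>"

lemma word_simps [simp]: "word [] = \<one>" "word (i # ws) = s i \<otimes> word ws"
  by (simp_all add: word_def)

lemma word_closed [simp]: "ws \<in> lists I \<Longrightarrow> word ws \<in> carrier G"
  by (induction ws) auto

lemma word_exists:
  assumes "g \<in> carrier G"
  shows "\<exists>ws\<in>lists I. word ws = g"
proof -
  obtain w where w: "w \<in> lists (I \<times> UNIV)" "eval_gword G s w = g"
    using eval_gword_generate[of s I g] assms generated by (auto simp: image_subset_iff)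
  have "word (map fst w) = eval_gword G s w"
    using w(1) by (induction w) (auto simp: eval_gword_def)
  moreover have "map fst w \<in> lists I"
    using w(1) by (induction w) auto
  ultimately show ?thesis
    using w(2) by blast
qed

lemma carrier_induct [consumes 1, case_names one step]:
  assumes "g \<in> carrier G" and "P \<one>"
    and "\<And>i h. i \<in> I \<Longrightarrow> h \<in> carrier G \<Longrightarrow> P h \<Longrightarrow> P (s i \<otimes> h)"
  shows "P g"
proof -
  obtain ws where "ws \<in> lists I" "word ws = g"
    using word_exists[OF assms(1)] by blast
  moreover have "ws \<in> lists I \<Longrightarrow> P (word ws)" for ws
    by (induction ws) (simp_all add: assms(2,3))
  ultimately show ?thesis by blast
qed

section \<open>The cocycle identity and the size of wall sets\<close>

text \<open>Induction on a word for \<open>g\<close>; \<open>N_step\<close> is the case of a single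
  generator, whose wall set is \<open>{s i}\<close>. Between truth values \<open>\<noteq>\<close> is
  exclusive or.\<close>

lemma N_mult:
  assumes "g \<in> carrier G" "h \<in> carrier G" "t \<in> carrier G"
  shows "t \<in> N (g \<otimes> h) \<longleftrightarrow> (t \<in> N g) \<noteq> (inv g \<otimes> t \<otimes> g \<in> N h)"
  using assms
proof (induction g arbitrary: t rule: carrier_induct)
  case one
  then show ?case by simp
next
  case (step i g)
  then show ?case
    using N_step[of i "g \<otimes> h" t] N_step[of i g t] step.IH[of "s i \<otimes> t \<otimes> s i"]
    by (simp add: m_assoc inv_mult_group) blast
qed

text \<open>Conjugation by \<open>s i\<close> fixes \<open>s i\<close>, so the two terms of the
  symmetric difference are disjoint.\<close>

lemma N_insert:
  assumes "i \<in> I" "h \<in> carrier G" "s i \<notin> N h"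
  shows "N (s i \<otimes> h) = insert (s i) ((\<lambda>t. s i \<otimes> t \<otimes> s i) ` N h)"
    (is "_ = insert _ (?f ` _)")
proof -
  have ff: "?f (?f t) = t" if "t \<in> carrier G" for t
    using that assms(1) by (simp add: m_assoc)
  have "t \<in> N (s i \<otimes> h) \<longleftrightarrow> t = s i \<or> ?f t \<in> N h" if "t \<in> carrier G" for t
    using N_step[OF assms(1,2) that] assms by auto
  moreover have "?f t \<in> N h \<longleftrightarrow> t \<in> ?f ` N h" if "t \<in> carrier G" for t
    using ff that N_closed[OF assms(2)] by (metis (no_types, lifting) image_iff subsetD)
  moreover have "?f ` N h \<subseteq> carrier G"
    using N_closed[OF assms(2)] assms(1) by auto
  ultimately show ?thesis
    using N_closed[of "s i \<otimes> h"] assms by auto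
qed

lemma finite_N: "g \<in> carrier G \<Longrightarrow> finite (N g)"
proof (induction g rule: carrier_induct)
  case one
  then show ?case by simp
next
  case (step i h)
  have "t \<in> insert (s i) ((\<lambda>t. s i \<otimes> t \<otimes> s i) ` N h)" if "t \<in> N (s i \<otimes> h)" for t
  proof -
    have t: "t \<in> carrier G"
      using that N_closed[of "s i \<otimes> h"] step.hyps by auto
    then have "s i \<otimes> (s i \<otimes> t \<otimes> s i) \<otimes> s i = t"
      using step.hyps by (simp add: m_assoc)
    then show ?thesis
      using N_step[OF step.hyps t] that by (metis image_eqI insert_iff)
  qed
  then show ?case
    using step.IH by (meson finite_imageI finite_insert finite_subset subsetI)
qed

lemma card_N_step:
  assumes "i \<in> I" "h \<in> carrier G" "s i \<notin> N h"
  shows "card (N (s i \<otimes> h)) = Suc (card (N h))"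
proof -
  let ?f = "\<lambda>t. s i \<otimes> t \<otimes> s i"
  have ff: "?f (?f t) = t" if "t \<in> carrier G" for t
    using that assms(1) by (simp add: m_assoc)
  have "inj_on ?f (N h)"
    using ff N_closed[OF assms(2)] by (metis (no_types, lifting) inj_onI subsetD)
  moreover have "s i \<notin> ?f ` N h"
  proof
    assume "s i \<in> ?f ` N h"
    then obtain t where "t \<in> N h" "?f t = s i" by auto
    then show False
      using ff[of t] N_closed[OF assms(2)] assms by auto
  qed
  ultimately show ?thesis
    using assms N_insert finite_N by (simp add: card_image)
qed

section \<open>Word length and the exchange condition\<close>

definition len :: "'a \<Rightarrow> nat" where
  "len g = (LEAST n. \<exists>ws\<in>lists I. length ws = n \<and> word ws = g)"

lemma len_le: "ws \<in> lists I \<Longrightarrow> len (word ws) \<le> length ws"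
  unfolding len_def by (rule Least_le) auto

lemma reduced_word_exists:
  assumes "g \<in> carrier G"
  obtains ws where "ws \<in> lists I" "length ws = len g" "word ws = g"
proof -
  have "\<exists>ws\<in>lists I. length ws = len g \<and> word ws = g"
    unfolding len_def by (rule LeastI_ex) (use word_exists[OF assms] in auto)
  then show ?thesis using that by blast
qed

text \<open>The exchange condition: a wall of a word comes from one of its letters, and multiplying
  by the reflection deletes that letter. Conjugation by the first letter passes to the tail.\<close>

lemma delete_letter:
  assumes "ws \<in> lists I" "t \<in> N (word ws)"
  shows "\<exists>js\<in>lists I. Suc (length js) = length ws \<and> t \<otimes> word ws = word js"
  using assms
proof (induction ws arbitrary: t)
  case Nil
  then show ?case by simp
next
  case (Cons i ws)
  have i: "i \<in> I" "ws \<in> lists I" using Cons.hyps by simp_all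
  have t: "t \<in> carrier G"
    using Cons.prems N_closed[of "word (i # ws)"] i by auto
  show ?case
  proof (cases "t = s i")
    case True
    then show ?thesis using i by (intro bexI[of _ ws]) auto
  next
    case False
    then have "s i \<otimes> t \<otimes> s i \<in> N (word ws)"
      using N_step[OF i(1) _ t, of "word ws"] Cons.prems i by simp
    then obtain js where js: "js \<in> lists I" "Suc (length js) = length ws"
      "s i \<otimes> t \<otimes> s i \<otimes> word ws = word js"
      using Cons.IH i by blast
    have "t \<otimes> word (i # ws) = s i \<otimes> (s i \<otimes> t \<otimes> s i \<otimes> word ws)"
      using i t by (simp add: m_assoc)
    then show ?thesis
      using js i by (intro bexI[of _ "i # js"]) auto
  qed
qed

lemma len_reflect_less:
  assumes "g \<in> carrier G" "t \<in> N g"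
  shows "len (t \<otimes> g) < len g"
proof -
  obtain ws where "ws \<in> lists I" "length ws = len g" "word ws = g"
    using reduced_word_exists[OF assms(1)] .
  then show ?thesis
    using delete_letter assms(2) len_le by (metis less_Suc_eq_le)
qed

lemma s_in_N_iff:
  assumes "i \<in> I" "h \<in> carrier G"
  shows "s i \<in> N (s i \<otimes> h) \<longleftrightarrow> s i \<notin> N h"
  using N_step[OF assms, of "s i"] assms by simp

text \<open>For the converse the reflection inequality is applied to \<open>s i \<otimes> g\<close>,
  since left multiplication by \<open>s i\<close> toggles membership of \<open>s i\<close> in the
  wall set.\<close>

lemma len_s_less_iff:
  assumes "i \<in> I" "g \<in> carrier G"
  shows "len (s i \<otimes> g) < len g \<longleftrightarrow> s i \<in> N g"
  using len_reflect_less[of g "s i"] len_reflect_less[of "s i \<otimes> g" "s i"] s_in_N_iff[OF assms] assms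
  by fastforce

text \<open>The first letter of a reduced word lengthens the tail, so it is not a wall of the tail,
  and each letter contributes exactly one wall.\<close>

lemma card_N:
  assumes "g \<in> carrier G"
  shows "card (N g) = len g"
  using assms
proof (induction "len g" arbitrary: g)
  case 0
  then have "g = \<one>"
    using reduced_word_exists[of g] by (metis length_0_conv word_simps(1))
  then show ?case using 0 by simp
next
  case (Suc n)
  obtain ws where ws: "ws \<in> lists I" "length ws = len g" "word ws = g"
    using reduced_word_exists[OF Suc.prems] .
  then obtain i js where js: "ws = i # js" "i \<in> I" "js \<in> lists I"
    using Suc.hyps(2) by (cases ws) auto
  have g: "g = s i \<otimes> word js" using ws js by simp
  have n: "len (word js) \<le> n"
    using len_le[OF js(3)] ws js Suc.hyps(2) by simp
  moreover obtain ks where "ks \<in> lists I" "length ks = len (word js)" "word ks = word js"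
    using reduced_word_exists[of "word js"] js by auto
  then have "len g \<le> Suc (len (word js))"
    using len_le[of "i # ks"] g js by simp
  ultimately have eq: "len (word js) = n" using Suc.hyps(2) by simp
  then have "s i \<notin> N (word js)"
    using len_s_less_iff[OF js(2), of "word js"] g js Suc.hyps(2) by auto
  then show ?case
    using card_N_step[OF js(2), of "word js"] Suc.hyps eq g js by simp
qed

text \<open>The second clause guarantees that the subtraction in the first one is not
  truncated.\<close>

lemma len_s:
  assumes "i \<in> I" "g \<in> carrier G"
  shows "len (s i \<otimes> g) = (if s i \<in> N g then len g - 1 else Suc (len g))"
    and "s i \<in> N g \<Longrightarrow> len g > 0"
proof -
  show "len (s i \<otimes> g) = (if s i \<in> N g then len g - 1 else Suc (len g))"
    using card_N_step[of i g] card_N_step[of i "s i \<otimes> g"] s_in_N_iff[OF assms] assms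
    by (auto simp flip: card_N)
  show "s i \<in> N g \<Longrightarrow> len g > 0"
    using len_s_less_iff[OF assms] by simp
qed

section \<open>The word metric\<close>

definition dst :: "'a \<Rightarrow> 'a \<Rightarrow> nat" where
  "dst u v = len (inv u \<otimes> v)"

text \<open>By the cocycle identity, conjugation by \<open>u\<close> matches the walls separating
  \<open>u\<close> from \<open>v\<close> with those separating \<open>\<one>\<close> from
  \<open>inv u \<otimes> v\<close>. Symmetry and the triangle inequality become facts about
  symmetric differences.\<close>

lemma dst_card:
  assumes "u \<in> carrier G" "v \<in> carrier G"
  shows "dst u v = card (N u - N v \<union> (N v - N u))"
proof -
  have "bij_betw (\<lambda>t. inv u \<otimes> t \<otimes> u) (N u - N v \<union> (N v - N u)) (N (inv u \<otimes> v))"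
  proof (rule bij_betw_byWitness[where f' = "\<lambda>t. u \<otimes> t \<otimes> inv u"])
    have eq: "t \<in> N v \<longleftrightarrow> (t \<in> N u) \<noteq> (inv u \<otimes> t \<otimes> u \<in> N (inv u \<otimes> v))"
      if "t \<in> carrier G" for t
      using N_mult[of u "inv u \<otimes> v" t] that assms by (simp flip: m_assoc)
    have sub: "N u \<subseteq> carrier G" "N v \<subseteq> carrier G" "N (inv u \<otimes> v) \<subseteq> carrier G"
      using N_closed assms by simp_all
    have c1: "u \<otimes> (inv u \<otimes> t \<otimes> u) \<otimes> inv u = t" "inv u \<otimes> (u \<otimes> t \<otimes> inv u) \<otimes> u = t"
      if "t \<in> carrier G" for t
      using that assms by (simp_all add: m_assoc inv_solve_left inv_solve_right) (simp_all flip: m_assoc)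
    show "\<forall>t\<in>N u - N v \<union> (N v - N u). u \<otimes> (inv u \<otimes> t \<otimes> u) \<otimes> inv u = t"
      "\<forall>t\<in>N (inv u \<otimes> v). inv u \<otimes> (u \<otimes> t \<otimes> inv u) \<otimes> u = t"
      using c1 sub by blast+
    show "(\<lambda>t. inv u \<otimes> t \<otimes> u) ` (N u - N v \<union> (N v - N u)) \<subseteq> N (inv u \<otimes> v)"
      using eq sub by blast
    show "(\<lambda>t. u \<otimes> t \<otimes> inv u) ` N (inv u \<otimes> v) \<subseteq> N u - N v \<union> (N v - N u)"
    proof clarsimp
      fix t assume t: "t \<in> N (inv u \<otimes> v)"
        "u \<otimes> t \<otimes> inv u \<in> N v \<longrightarrow> u \<otimes> t \<otimes> inv u \<in> N u"
      then have tc: "t \<in> carrier G" using sub by blast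
      then show "u \<otimes> t \<otimes> inv u \<in> N u \<and> u \<otimes> t \<otimes> inv u \<notin> N v"
        using eq[of "u \<otimes> t \<otimes> inv u"] c1(2)[OF tc] t assms by auto
    qed
  qed
  then show ?thesis
    using bij_betw_same_card card_N assms unfolding dst_def by fastforce
qed

lemma len_eq_0: "g \<in> carrier G \<Longrightarrow> len g = 0 \<longleftrightarrow> g = \<one>"
  using reduced_word_exists[of g] len_le[of "[]"]
  by (metis bot_nat_0.extremum_uniqueI length_0_conv lists.Nil list.size(3) word_simps(1))

lemma dst_eq_0:
  assumes "u \<in> carrier G" "v \<in> carrier G"
  shows "dst u v = 0 \<longleftrightarrow> u = v"
  using assms len_eq_0[of "inv u \<otimes> v"] unfolding dst_def
  by (metis inv_closed inv_equality inv_inv l_inv m_closed)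

lemma dst_sym: "u \<in> carrier G \<Longrightarrow> v \<in> carrier G \<Longrightarrow> dst u v = dst v u"
  by (simp add: dst_card Un_commute)

lemma dst_triangle:
  assumes "u \<in> carrier G" "v \<in> carrier G" "w \<in> carrier G"
  shows "dst u w \<le> dst u v + dst v w"
proof -
  have "card (N u - N w \<union> (N w - N u))
      \<le> card ((N u - N v \<union> (N v - N u)) \<union> (N v - N w \<union> (N w - N v)))"
    using finite_N assms by (intro card_mono) auto
  also have "\<dots> \<le> card (N u - N v \<union> (N v - N u)) + card (N v - N w \<union> (N w - N v))"
    by (rule card_Un_le)
  finally show ?thesis
    using assms by (simp add: dst_card)
qed

text \<open>When the distances add up, no wall is crossed twice on the way from \<open>u\<close>
  through \<open>w\<close> to \<open>v\<close>: the two symmetric differences are disjoint.\<close>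

lemma dst_between:
  assumes "u \<in> carrier G" "v \<in> carrier G" "w \<in> carrier G"
    and "dst u w + dst w v = dst u v"
  shows "N u \<inter> N v \<subseteq> N w" "N w \<subseteq> N u \<union> N v"
proof -
  let ?A = "N u - N w \<union> (N w - N u)" and ?B = "N w - N v \<union> (N v - N w)"
  have fin: "finite ?A" "finite ?B" using finite_N assms by auto
  have "card (N u - N v \<union> (N v - N u)) \<le> card (?A \<union> ?B)"
    using fin by (intro card_mono) auto
  then have "card (?A \<inter> ?B) = 0"
    using assms card_Un_Int[OF fin] by (simp add: dst_card)
  then have "?A \<inter> ?B = {}"
    using fin by simp
  then show "N u \<inter> N v \<subseteq> N w" "N w \<subseteq> N u \<union> N v" by blast+
qed

lemma dst_s:
  assumes "i \<in> I" "g \<in> carrier G" "x \<in> carrier G"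
  shows "dst (g \<otimes> s i) x = len (s i \<otimes> (inv g \<otimes> x))"
  using assms by (simp add: dst_def inv_mult_group m_assoc)

lemma dst_s_eq_1:
  assumes "i \<in> I" "g \<in> carrier G"
  shows "dst g (g \<otimes> s i) = 1"
  using len_s[of i \<one>] len_eq_0[of \<one>] assms unfolding dst_def by (simp flip: m_assoc)

lemma dst_eq_1:
  assumes "u \<in> carrier G" "v \<in> carrier G" "dst u v = 1"
  obtains i where "i \<in> I" "v = u \<otimes> s i"
proof -
  obtain ws where "ws \<in> lists I" "length ws = 1" "word ws = inv u \<otimes> v"
    using reduced_word_exists[of "inv u \<otimes> v"] assms unfolding dst_def by auto
  then obtain i where "i \<in> I" "s i = inv u \<otimes> v"
    by (cases ws) auto
  then show ?thesis
    using that[of i] assms by (metis inv_solve_left s_closed)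
qed

lemma dst_step:
  assumes "u \<in> carrier G" "v \<in> carrier G" "dst u v = Suc n"
  shows "\<exists>z\<in>carrier G. dst u z = 1 \<and> dst z v = n"
proof -
  obtain ws where ws: "ws \<in> lists I" "length ws = Suc n" "word ws = inv u \<otimes> v"
    using reduced_word_exists[of "inv u \<otimes> v"] assms unfolding dst_def by auto
  then obtain i js where js: "ws = i # js" "i \<in> I" "js \<in> lists I" "length js = n"
    by (cases ws) auto
  have "dst (u \<otimes> s i) v = len (word js)"
    using dst_s[OF js(2) assms(1,2)] js by (simp flip: ws(3))
  then have "dst (u \<otimes> s i) v \<le> n"
    using len_le[OF js(3)] js by simp
  moreover have "dst u v \<le> dst u (u \<otimes> s i) + dst (u \<otimes> s i) v"
    using assms js by (intro dst_triangle) simp_all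
  ultimately show ?thesis
    using assms js dst_s_eq_1[OF js(2) assms(1)] by (intro bexI[of _ "u \<otimes> s i"]) auto
qed

text \<open>A generator changes the length by exactly one.\<close>

lemma dst_bipartite:
  assumes "x \<in> carrier G" "y \<in> carrier G" "z \<in> carrier G" "dst x y = 1"
  shows "dst z x \<noteq> dst z y"
proof -
  obtain i where i: "i \<in> I" "y = x \<otimes> s i" using dst_eq_1 assms by metis
  then have "dst y z \<noteq> dst x z"
    using dst_s[OF i(1) assms(1,3)] len_s[of i "inv x \<otimes> z"] assms unfolding dst_def by auto
  then show ?thesis using dst_sym assms by metis
qed

section \<open>The Cayley graph and its half-spaces\<close>

lemma relpow_cayley_edges:
  assumes "u \<in> carrier G"
  shows "(u, v) \<in> cayley_edges G I s ^^ n \<longleftrightarrow> (\<exists>ws\<in>lists I. length ws = n \<and> v = u \<otimes> word ws)"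
  using assms
proof (induction n arbitrary: u)
  case 0
  then show ?case by auto
next
  case (Suc n)
  \<comment> \<open>The generators are involutions, so the two directions in
    \<open>cayley_edges\<close> coincide.\<close>
  have edge: "(u, y) \<in> cayley_edges G I s \<longleftrightarrow> (\<exists>i\<in>I. y = u \<otimes> s i)" for y
  proof -
    have "u = y \<otimes> s i \<longleftrightarrow> y = u \<otimes> s i" if "i \<in> I" "y \<in> carrier G" for i
      using that Suc.prems by (auto simp: m_assoc)
    then show ?thesis
      using Suc.prems by (auto simp: cayley_edges_def)
  qed
  have "(u, v) \<in> cayley_edges G I s ^^ Suc n \<longleftrightarrow>
      (\<exists>y. (u, y) \<in> cayley_edges G I s \<and> (y, v) \<in> cayley_edges G I s ^^ n)"
    by (meson relpow_Suc_D2 relpow_Suc_I2)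
  also have "\<dots> \<longleftrightarrow> (\<exists>i\<in>I. \<exists>ws\<in>lists I. length ws = n \<and> v = u \<otimes> s i \<otimes> word ws)"
  proof -
    have "(u \<otimes> s i, v) \<in> cayley_edges G I s ^^ n \<longleftrightarrow>
        (\<exists>ws\<in>lists I. length ws = n \<and> v = u \<otimes> s i \<otimes> word ws)" if "i \<in> I" for i
      using Suc.IH[of "u \<otimes> s i"] Suc.prems that by simp
    then show ?thesis
      unfolding edge by blast
  qed
  also have "\<dots> \<longleftrightarrow> (\<exists>i\<in>I. \<exists>ws\<in>lists I. length (i # ws) = Suc n \<and> v = u \<otimes> word (i # ws))"
    using Suc.prems by (auto simp: m_assoc)
  also have "\<dots> \<longleftrightarrow> (\<exists>ws\<in>lists I. length ws = Suc n \<and> v = u \<otimes> word ws)"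
    (is "?l \<longleftrightarrow> ?r")
  proof
    assume ?r
    then obtain ws where "ws \<in> lists I" "length ws = Suc n" "v = u \<otimes> word ws" by blast
    then show ?l by (cases ws) auto
  next
    assume ?l
    then obtain i ws where "i \<in> I" "ws \<in> lists I" "length (i # ws) = Suc n"
      "v = u \<otimes> word (i # ws)" by blast
    then show ?r by (intro bexI[of _ "i # ws"]) auto
  qed
  finally show ?case .
qed

lemma graph_dist_cayley:
  assumes "u \<in> carrier G" "v \<in> carrier G"
  shows "graph_dist (cayley_edges G I s) u v = dst u v"
proof -
  have "v = u \<otimes> word ws \<longleftrightarrow> word ws = inv u \<otimes> v" if "ws \<in> lists I" for ws
    using that assms by (metis inv_solve_left word_closed)
  then have "(u, v) \<in> cayley_edges G I s ^^ n \<longleftrightarrow>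
      (\<exists>ws\<in>lists I. length ws = n \<and> word ws = inv u \<otimes> v)" for n
    using relpow_cayley_edges[OF assms(1)] by blast
  then show ?thesis
    unfolding graph_dist_def dst_def len_def by presburger
qed

text \<open>By \<open>dst_between\<close>, a vertex between \<open>u\<close> and \<open>v\<close>
  has every wall common to \<open>N u\<close> and \<open>N v\<close> and none that is missing from
  both.\<close>

lemma halfspace_convex:
  shows "graph_convex (carrier G) (cayley_edges G I s) {g \<in> carrier G. t \<in> N g}"
    and "graph_convex (carrier G) (cayley_edges G I s) {g \<in> carrier G. t \<notin> N g}"
proof -
  have between: "N u \<inter> N v \<subseteq> N w \<and> N w \<subseteq> N u \<union> N v"
    if "u \<in> carrier G" "v \<in> carrier G" "w \<in> carrier G"
      "graph_dist (cayley_edges G I s) u w + graph_dist (cayley_edges G I s) w v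
        = graph_dist (cayley_edges G I s) u v" for u v w
    using dst_between[of u v w] that by (simp add: graph_dist_cayley)
  show "graph_convex (carrier G) (cayley_edges G I s) {g \<in> carrier G. t \<in> N g}"
    using between unfolding graph_convex_def by blast
  show "graph_convex (carrier G) (cayley_edges G I s) {g \<in> carrier G. t \<notin> N g}"
    using between unfolding graph_convex_def by blast
qed

text \<open>The distance counts the walls in which \<open>N x\<close> and \<open>N y\<close> differ,
  so distinct elements differ in some wall.\<close>

lemma halfspaces_separate:
  assumes "x \<in> carrier G" "y \<in> carrier G" "x \<noteq> y"
  shows "\<exists>H. graph_convex (carrier G) (cayley_edges G I s) H \<and>
    graph_convex (carrier G) (cayley_edges G I s) (carrier G - H) \<and> x \<in> H \<and> y \<notin> H"
proof -
  have "N x \<noteq> N y"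
    using dst_eq_0[of x y] assms by (auto simp: dst_card)
  then obtain t where "(t \<in> N x) \<noteq> (t \<in> N y)" by blast
  moreover have "carrier G - {g \<in> carrier G. t \<in> N g} = {g \<in> carrier G. t \<notin> N g}"
    "carrier G - {g \<in> carrier G. t \<notin> N g} = {g \<in> carrier G. t \<in> N g}" for t by blast+
  ultimately show ?thesis
    using halfspace_convex[of t] assms
    by (cases "t \<in> N x")
      (rule exI[of _ "{g \<in> carrier G. t \<in> N g}"], simp, rule exI[of _ "{g \<in> carrier G. t \<notin> N g}"], simp)
qed

section \<open>Dihedral subgroups and the quadrangle condition\<close>

fun alt :: "nat \<Rightarrow> 'a \<Rightarrow> 'a \<Rightarrow> 'a" where
  "alt 0 a b = \<one>"
| "alt (Suc n) a b = a \<otimes> alt n b a"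

lemma alt_closed [simp]: "a \<in> carrier G \<Longrightarrow> b \<in> carrier G \<Longrightarrow> alt n a b \<in> carrier G"
  by (induction n arbitrary: a b) auto

text \<open>All walls of an alternating word are reflections of the dihedral subgroup. Peeling off
  the first letter swaps the generators, and conjugating back raises the exponent by one.\<close>

lemma N_alt:
  assumes "i \<in> I" "j \<in> I" "t \<in> N (alt n (s i) (s j))"
  shows "\<exists>k::nat. t = (s i \<otimes> s j) [^] k \<otimes> s i"
  using assms
proof (induction n arbitrary: i j t)
  case 0
  then show ?case by simp
next
  case (Suc n)
  have t: "t \<in> carrier G"
    using Suc.prems N_closed[of "alt (Suc n) (s i) (s j)"] by auto
  show ?case
  proof (cases "t = s i")
    case True
    then show ?thesis using Suc.prems by (intro exI[of _ 0]) simp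
  next
    case False
    then have "s i \<otimes> t \<otimes> s i \<in> N (alt n (s j) (s i))"
      using N_step[OF Suc.prems(1) _ t] Suc.prems by simp
    then obtain k :: nat where k: "s i \<otimes> t \<otimes> s i = (s j \<otimes> s i) [^] k \<otimes> s j"
      using Suc.IH Suc.prems by blast
    have shift: "s i \<otimes> (s j \<otimes> s i) [^] k = (s i \<otimes> s j) [^] k \<otimes> s i" for k :: nat
    proof (induction k)
      case 0
      then show ?case using Suc.prems by simp
    next
      case IH: (Suc k)
      have "s i \<otimes> (s j \<otimes> s i) [^] Suc k = s i \<otimes> (s j \<otimes> s i) [^] k \<otimes> (s j \<otimes> s i)"
        using Suc.prems by (simp add: m_assoc)
      then show ?case
        using Suc.prems by (simp add: IH m_assoc)
    qed
    have "t = s i \<otimes> (s i \<otimes> t \<otimes> s i) \<otimes> s i"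
      using t Suc.prems by (simp add: m_assoc)
    also have "\<dots> = s i \<otimes> (s j \<otimes> s i) [^] k \<otimes> s j \<otimes> s i"
      using Suc.prems by (simp add: k m_assoc)
    also have "\<dots> = (s i \<otimes> s j) [^] Suc k \<otimes> s i"
      using Suc.prems by (simp add: shift m_assoc)
    finally show ?thesis by blast
  qed
qed

text \<open>If two descents of \<open>u\<close> generated an infinite dihedral group, then every alternating word in
  them would be a prefix of \<open>u\<close>.\<close>

lemma no_common_descents_if_infinite_order:
  assumes ij: "i \<in> I" "j \<in> I" and u: "u \<in> carrier G" "s i \<in> N u" "s j \<in> N u"
    and inf: "\<And>n. n > 0 \<Longrightarrow> (s i \<otimes> s j) [^] (n::nat) \<noteq> \<one>"
      "\<And>n. n > 0 \<Longrightarrow> (s j \<otimes> s i) [^] (n::nat) \<noteq> \<one>"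
  shows False
proof -
  \<comment> \<open>Stripping an alternating prefix of \<open>n\<close> letters shortens
    \<open>u\<close> by at least \<open>n\<close>, which is absurd once \<open>n\<close> exceeds
    \<open>len u\<close>. The indices vary in the induction because \<open>alt\<close> swaps them at
    each step.\<close>
  have "len (inv (alt n (s i) (s j)) \<otimes> u) + n \<le> len u" for n
    using ij u inf
  proof (induction n arbitrary: i j)
    case 0
    then show ?case by simp
  next
    case (Suc n)
    let ?w = "alt n (s j) (s i)"
    let ?y = "inv ?w \<otimes> u"
    have w: "?w \<in> carrier G" "?y \<in> carrier G" using Suc.prems by simp_all
    have IH: "len ?y + n \<le> len u"
      using Suc.IH[of j i] Suc.prems by blast
    \<comment> \<open>Otherwise \<open>N_alt\<close> would give a positive power of
      \<open>s j \<otimes> s i\<close> equal to \<open>\<one>\<close>.\<close>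
    have "s i \<notin> N ?w"
    proof
      assume "s i \<in> N ?w"
      then obtain k :: nat where "s i = (s j \<otimes> s i) [^] k \<otimes> s j"
        using N_alt Suc.prems by blast
      then have "(s j \<otimes> s i) [^] k \<otimes> s j \<otimes> s i = \<one>"
        using Suc.prems by simp
      then have "(s j \<otimes> s i) [^] Suc k = \<one>"
        using Suc.prems by (simp add: m_assoc)
      then show False
        using Suc.prems(7)[of "Suc k"] by blast
    qed
    moreover have "?w \<otimes> ?y = u"
      using w u by (simp flip: m_assoc)
    \<comment> \<open>The wall \<open>s i\<close> of \<open>u = ?w \<otimes> ?y\<close> must come
      from \<open>?y\<close>. Reflecting \<open>?y\<close> in it strips the next longer alternating
      word from \<open>u\<close>.\<close>
    ultimately have "inv ?w \<otimes> s i \<otimes> ?w \<in> N ?y"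
      using N_mult[OF w, of "s i"] Suc.prems by simp
    then have "len (inv ?w \<otimes> s i \<otimes> ?w \<otimes> ?y) < len ?y"
      using len_reflect_less w by blast
    moreover have "inv ?w \<otimes> s i \<otimes> ?w \<otimes> ?y = inv (alt (Suc n) (s i) (s j)) \<otimes> u"
      using w u Suc.prems \<open>?w \<otimes> ?y = u\<close> by (simp add: m_assoc inv_mult_group)
    ultimately show ?case using IH by simp
  qed
  from this[of "Suc (len u)"] show False by simp
qed

text \<open>Two neighbours of \<open>g\<close> nearer to \<open>x\<close> are two descents of
  \<open>inv g \<otimes> x\<close>. The assumption forces them to commute, and commuting descents
  span the square that the quadrangle condition asks for.\<close>

theorem strong_hull_property_cayley:
  assumes inf: "\<And>i j n. i \<in> I \<Longrightarrow> j \<in> I \<Longrightarrow> s i \<otimes> s j \<noteq> s j \<otimes> s i \<Longrightarrow> n > 0 \<Longrightarrow>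
    (s i \<otimes> s j) [^] (n::nat) \<noteq> \<one>"
  shows "strong_hull_property (carrier G) (cayley_edges G I s)"
proof (rule strong_hull_property_if_medians)
  have quad: "\<exists>h\<in>carrier G. dst h p = 1 \<and> dst h q = 1 \<and> dst x h + 2 = dst x g"
    if V: "x \<in> carrier G" "g \<in> carrier G" "p \<in> carrier G" "q \<in> carrier G"
      and D: "p \<noteq> q" "dst g p = 1" "dst g q = 1" "dst x p < dst x g" "dst x q < dst x g" for x g p q
  proof -
    obtain i where i: "i \<in> I" "p = g \<otimes> s i"
      using dst_eq_1[OF V(2,3) D(2)] .
    obtain j where j: "j \<in> I" "q = g \<otimes> s j"
      using dst_eq_1[OF V(2,4) D(3)] .
    note ij = i j
    let ?u = "inv g \<otimes> x"
    have u: "?u \<in> carrier G" using V by simp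
    have "dst p x < dst g x" "dst q x < dst g x"
      using D(4,5) V by (simp_all add: dst_sym[of x])
    then have "len (s i \<otimes> ?u) < len ?u" "len (s j \<otimes> ?u) < len ?u"
      using ij V by (simp_all only: dst_s) (simp_all only: dst_def)
    then have N: "s i \<in> N ?u" "s j \<in> N ?u"
      using ij u len_s_less_iff by blast+
    have comm: "s i \<otimes> s j = s j \<otimes> s i"
    proof (rule ccontr)
      assume "s i \<otimes> s j \<noteq> s j \<otimes> s i"
      then show False
        using no_common_descents_if_infinite_order[OF ij(1,3) u N] inf[OF ij(1,3)] inf[OF ij(3,1)] by auto
    qed
    have "s i \<noteq> s j" using D(1) ij by auto
    moreover have "s j \<otimes> s i \<otimes> s j = s i"
      using comm ij by (simp add: m_assoc)
    \<comment> \<open>As \<open>s i\<close> commutes with \<open>s j\<close> and differs from it, it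
      is still a descent after \<open>s j\<close> has been removed, so the length drops by two in
      total.\<close>
    ultimately have Ni: "s i \<in> N (s j \<otimes> ?u)"
      using N_step[of j ?u "s i"] ij u N by simp
    let ?h = "g \<otimes> s j \<otimes> s i"
    have "dst ?h x = len (s i \<otimes> (s j \<otimes> ?u))"
      using dst_s[of i "g \<otimes> s j" x] ij V by (simp add: inv_mult_group m_assoc)
    then have "dst ?h x + 2 = dst g x"
      using len_s[of i "s j \<otimes> ?u"] len_s[of j ?u] Ni N ij u by (simp add: dst_def)
    moreover have "dst q ?h = 1" using dst_s_eq_1 ij V by simp
    moreover have "?h = p \<otimes> s j"
      using ij V comm by (simp add: m_assoc)
    then have "dst p ?h = 1" using dst_s_eq_1 ij V by simp
    ultimately show ?thesis
      using V ij dst_sym[of ?h] dst_sym[of g x] by (intro bexI[of _ ?h]) simp_all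
  qed
  fix x u v
  assume V: "x \<in> carrier G" "u \<in> carrier G" "v \<in> carrier G"
  obtain p where "p \<in> carrier G" "dst x p + dst p u = dst x u"
    "dst x p + dst p v = dst x v" "dst u p + dst p v = dst u v"
    using median_if_quadrangle[of "carrier G" dst x u v,
        OF dst_eq_0 dst_sym dst_triangle dst_step dst_bipartite quad V] by blast
  then show "\<exists>p\<in>carrier G.
      graph_dist (cayley_edges G I s) x p + graph_dist (cayley_edges G I s) p u
        = graph_dist (cayley_edges G I s) x u \<and>
      graph_dist (cayley_edges G I s) x p + graph_dist (cayley_edges G I s) p v
        = graph_dist (cayley_edges G I s) x v \<and>
      graph_dist (cayley_edges G I s) u p + graph_dist (cayley_edges G I s) p v
        = graph_dist (cayley_edges G I s) u v"
    using V by (intro bexI[of _ p]) (simp_all add: graph_dist_cayley)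
qed (rule halfspaces_separate)

end

section \<open>Right-angled Coxeter groups\<close>

text \<open>An action of letters in which cancelling pairs and relators are trivial factors through
  the presented group. It is applied below to sets of reflections and to the integers.\<close>

lemma pres_equiv_foldr:
  assumes z: "z \<in> Z"
    and closed: "\<And>i e z. i \<in> I \<Longrightarrow> z \<in> Z \<Longrightarrow> F (i, e) z \<in> Z"
    and cancel: "\<And>i e z. i \<in> I \<Longrightarrow> z \<in> Z \<Longrightarrow> F (i, e) (F (i, \<not> e) z) = z"
    and relator: "\<And>r z. r \<in> R \<Longrightarrow> z \<in> Z \<Longrightarrow> foldr F r z = z"
    and R: "R \<subseteq> lists (I \<times> UNIV)"
    and uv: "pres_equiv I R u v" "u \<in> lists (I \<times> UNIV)"
  shows "foldr F u z = foldr F v z"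
proof -
  have Z: "foldr F u z \<in> Z" if "u \<in> lists (I \<times> UNIV)" for u
    using that by (induction u) (auto simp: z closed)
  \<comment> \<open>\<open>pres_equiv\<close> is defined on all words, so the induction must also
    show that the intermediate word in \<open>trans\<close> has its letters in
    \<open>I\<close>.\<close>
  from uv(1) have "(u \<in> lists (I \<times> UNIV) \<longleftrightarrow> v \<in> lists (I \<times> UNIV)) \<and>
      (u \<in> lists (I \<times> UNIV) \<longrightarrow> foldr F u z = foldr F v z)"
  proof induction
    case (cancel i u e v)
    then show ?case using Z[of v] assms(3) by auto
  next
    case (relator r u v)
    then have "r \<in> lists (I \<times> UNIV)" using R by blast
    then show ?case using relator Z[of v] assms(4) by auto
  qed auto
  then show ?thesis using uv(2) by blast
qed

text \<open>Off-diagonal entries are at least \<open>2\<close>, so the finite ones are exactly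
  \<open>2\<close>.\<close>

lemma right_angled_relator_cases:
  assumes "coxeter_matrix r m" "right_angled r m" "w \<in> coxeter_relators r m"
  obtains i where "i \<in> {1..r}" "w = [(i, True), (i, True)]"
  | i j where "i \<in> {1..r}" "j \<in> {1..r}" "i \<noteq> j" "m i j = 2"
      "w = [(i, True), (j, True), (i, True), (j, True)]"
proof -
  obtain i j k where ij: "i \<in> {1..r}" "j \<in> {1..r}" "m i j = enat k"
    "w = concat (replicate k [(i, True), (j, True)])"
    using assms(3) unfolding coxeter_relators_def by blast
  show ?thesis
  proof (cases "i = j")
    case True
    then have "m i j = 1" using assms(1) ij unfolding coxeter_matrix_def by blast
    then have "k = 1" using ij by (simp add: one_enat_def)
    then show ?thesis using that(1) True ij by simp
  next
    case False
    then have "m i j \<ge> 2" using assms(1) ij unfolding coxeter_matrix_def by blast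
    moreover have "m i j \<in> {1, 2, \<infinity>}" using assms(2) ij unfolding right_angled_def by blast
    ultimately have "m i j = 2" using ij by (auto simp: one_enat_def numeral_eq_enat)
    then have "k = 2" using ij by (simp add: numeral_eq_enat)
    then show ?thesis using that(2)[OF ij(1,2) False] \<open>m i j = 2\<close> ij by (simp add: numeral_2_eq_2)
  qed
qed

theorem theorem1p5:
  fixes W :: "('g, 'b) monoid_scheme"
    and r :: nat
    and s :: "nat \<Rightarrow> 'g"
    and m :: "nat \<Rightarrow> nat \<Rightarrow> enat"
  assumes "coxeter_system W r s m"
    and "right_angled r m"
  shows "strong_hull_property (carrier W) (cayley_edges W {1..r} s)"
proof -
  define I where "I = {1..r}"
  let ?R = "coxeter_relators r m"
  let ?L = "lists (I \<times> (UNIV :: bool set))"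
  have mat: "coxeter_matrix r m" and pres: "has_presentation W I s ?R"
    using assms(1) unfolding coxeter_system_def I_def by auto
  interpret W: group W using pres unfolding has_presentation_def by blast
  note [simp] = W.m_assoc
  have gen: "generate W (s ` I) = carrier W" and sI: "s ` I \<subseteq> carrier W"
    using pres unfolding has_presentation_def by auto
  have sc [simp]: "s i \<in> carrier W" if "i \<in> I" for i using that sI by blast
  have eval_iff: "eval_gword W s u = eval_gword W s v \<longleftrightarrow> pres_equiv I ?R u v"
    if "u \<in> ?L" "v \<in> ?L" for u v
    using pres that unfolding has_presentation_def by blast
  note relator_cases = right_angled_relator_cases[OF mat assms(2), folded I_def]
  have RL: "?R \<subseteq> ?L"
    by (rule subsetI, erule relator_cases) auto
  have eval_Nil: "eval_gword W s [] = \<one>\<^bsub>W\<^esub>" by (simp add: eval_gword_def)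
  have eval_True: "eval_gword W s ((i, True) # w) = s i \<otimes>\<^bsub>W\<^esub> eval_gword W s w" for i w
    by (simp add: eval_gword_def)
  have rel1: "eval_gword W s w = \<one>\<^bsub>W\<^esub>" if "w \<in> ?R" for w
    using eval_iff[of w "[]"] pres_equiv.relator[OF that, of I "[]" "[]"] RL that
    by (auto simp: eval_Nil)
  have sq [simp]: "s i \<otimes>\<^bsub>W\<^esub> s i = \<one>\<^bsub>W\<^esub>" if i: "i \<in> I" for i
  proof -
    have "m i i = enat 1" using mat i unfolding coxeter_matrix_def I_def by (simp add: one_enat_def)
    then have "concat (replicate 1 [(i, True), (i, True)]) \<in> ?R"
      unfolding coxeter_relators_def I_def[symmetric] using i by blast
    then show ?thesis using rel1 i by (fastforce simp: eval_True eval_Nil)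
  qed
  have sq2 [simp]: "s i \<otimes>\<^bsub>W\<^esub> (s i \<otimes>\<^bsub>W\<^esub> g) = g" if "i \<in> I" "g \<in> carrier W" for i g
    using that W.m_assoc[of "s i" "s i" g] by (simp del: W.m_assoc)
  have comm: "s i \<otimes>\<^bsub>W\<^esub> s j = s j \<otimes>\<^bsub>W\<^esub> s i" if ij: "i \<in> I" "j \<in> I" "m i j = 2" for i j
  proof -
    have "concat (replicate 2 [(i, True), (j, True)]) \<in> ?R"
      unfolding coxeter_relators_def I_def[symmetric] using ij by (simp add: numeral_eq_enat) blast
    then have "s i \<otimes>\<^bsub>W\<^esub> (s j \<otimes>\<^bsub>W\<^esub> (s i \<otimes>\<^bsub>W\<^esub> s j)) = \<one>\<^bsub>W\<^esub>"
      using rel1 ij by (fastforce simp: eval_True eval_Nil numeral_2_eq_2)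
    \<comment> \<open>Multiplying by \<open>s j\<close> and \<open>s i\<close> from the left cancels
      the first half of the relator.\<close>
    then have "s j \<otimes>\<^bsub>W\<^esub> (s i \<otimes>\<^bsub>W\<^esub> (s i \<otimes>\<^bsub>W\<^esub> (s j \<otimes>\<^bsub>W\<^esub> (s i \<otimes>\<^bsub>W\<^esub> s j)))) = s j \<otimes>\<^bsub>W\<^esub> s i"
      using ij by simp
    then show ?thesis using ij by simp
  qed

  \<comment> \<open>The reflection cocycle of a right-angled Coxeter group\<close>
  \<comment> \<open>A letter conjugates a set of reflections by \<open>s i\<close> and then toggles
    \<open>s i\<close>, whatever its sign. Folding over a word records the reflections that occur an
    odd number of times.\<close>
  define F where "F = (\<lambda>(i::nat, e::bool) A.
    {t \<in> carrier W. (t = s i) \<noteq> (s i \<otimes>\<^bsub>W\<^esub> t \<otimes>\<^bsub>W\<^esub> s i \<in> A)})"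
  have F: "t \<in> F (i, e) A \<longleftrightarrow> t \<in> carrier W \<and> (t = s i) \<noteq> (s i \<otimes>\<^bsub>W\<^esub> t \<otimes>\<^bsub>W\<^esub> s i \<in> A)" for t i e A
    by (simp add: F_def)
  \<comment> \<open>Conjugation by \<open>s i\<close> fixes \<open>s j\<close> if they are equal or
    commute; this settles both kinds of relators, through \<open>FF\<close> and
    \<open>Fcomm\<close>.\<close>
  have conj_eq: "s i \<otimes>\<^bsub>W\<^esub> (t \<otimes>\<^bsub>W\<^esub> s i) = s j \<longleftrightarrow> t = s j"
    if "i \<in> I" "j \<in> I" "t \<in> carrier W" "i = j \<or> m i j = 2" for i j t
  proof -
    have c: "s i \<otimes>\<^bsub>W\<^esub> s j = s j \<otimes>\<^bsub>W\<^esub> s i" using that comm by blast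
    have "t = s i \<otimes>\<^bsub>W\<^esub> (s i \<otimes>\<^bsub>W\<^esub> (t \<otimes>\<^bsub>W\<^esub> s i)) \<otimes>\<^bsub>W\<^esub> s i" using that by simp
    moreover have "s i \<otimes>\<^bsub>W\<^esub> s j \<otimes>\<^bsub>W\<^esub> s i = s j" "s i \<otimes>\<^bsub>W\<^esub> (s j \<otimes>\<^bsub>W\<^esub> s i) = s j"
      using that c W.m_assoc[of "s j" "s i" "s i"] by (simp_all del: W.m_assoc add: c) (simp_all flip: c)
    ultimately show ?thesis by metis
  qed
  have FF: "F (i, e) (F (i, e') A) = A" if "i \<in> I" "A \<subseteq> carrier W" for i e e' A
  proof (rule Set.set_eqI)
    fix t
    show "t \<in> F (i, e) (F (i, e') A) \<longleftrightarrow> t \<in> A"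
      using that conj_eq[of i i t] by (cases "t \<in> carrier W") (auto simp: F)
  qed
  have Fcomm: "F (i, e) (F (j, e') A) = F (j, e') (F (i, e) A)"
    if ij: "i \<in> I" "j \<in> I" "m i j = 2" for i j e e' A
  proof -
    have ji: "m j i = 2" using mat ij unfolding coxeter_matrix_def I_def by auto
    have "s j \<otimes>\<^bsub>W\<^esub> (s i \<otimes>\<^bsub>W\<^esub> (t \<otimes>\<^bsub>W\<^esub> (s i \<otimes>\<^bsub>W\<^esub> s j)))
        = s i \<otimes>\<^bsub>W\<^esub> (s j \<otimes>\<^bsub>W\<^esub> (t \<otimes>\<^bsub>W\<^esub> (s j \<otimes>\<^bsub>W\<^esub> s i)))" if "t \<in> carrier W" for t
    proof -
      have "s j \<otimes>\<^bsub>W\<^esub> (s i \<otimes>\<^bsub>W\<^esub> x) = s i \<otimes>\<^bsub>W\<^esub> (s j \<otimes>\<^bsub>W\<^esub> x)" if "x \<in> carrier W" for x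
        using W.m_assoc[of "s j" "s i" x] W.m_assoc[of "s i" "s j" x] comm[OF ij] ij that
        by (simp del: W.m_assoc)
      then show ?thesis
        using comm[OF ij] that ij by simp
    qed
    then show ?thesis
      using ij ji by (auto simp: F conj_eq)
  qed
  define par where "par w = foldr F w {}" for w
  have par_eq: "par u = par v" if "u \<in> ?L" "v \<in> ?L" "eval_gword W s u = eval_gword W s v" for u v
    unfolding par_def
  proof (rule pres_equiv_foldr[where Z = "Pow (carrier W)" and I = I and R = ?R])
    show "pres_equiv I ?R u v" using eval_iff that by blast
    show "F (i, e) z \<in> Pow (carrier W)" for i e z by (auto simp: F)
    show "foldr F w z = z" if "w \<in> ?R" "z \<in> Pow (carrier W)" for w z
    proof -
      have sub: "F (i, e) z \<subseteq> carrier W" for i e z by (auto simp: F)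
      have zW: "z \<subseteq> carrier W" using that(2) by simp
      show ?thesis
      proof (rule relator_cases[OF that(1)])
        fix i assume "i \<in> I" "w = [(i, True), (i, True)]"
        then show ?thesis using FF zW by simp
      next
        fix i j assume ij: "i \<in> I" "j \<in> I" "m i j = 2"
          and w: "w = [(i, True), (j, True), (i, True), (j, True)]"
        have "F (j, True) (F (i, True) (F (j, True) z)) = F (i, True) z"
          using Fcomm[OF ij, of True True "F (j, True) z"] FF[OF ij(2) zW] by simp
        then show ?thesis using FF[OF ij(1) zW] w by simp
      qed
    qed
  qed (use FF RL that in auto)
  have par_sub: "par w \<subseteq> carrier W" if "w \<in> ?L" for w
    using that by (induction w) (auto simp: par_def F)

  \<comment> \<open>A union over all words for \<open>g\<close> avoids choosing one; by
    \<open>par_eq\<close> they all give the same set.\<close>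
  define N where "N g = {t. \<exists>w\<in>?L. eval_gword W s w = g \<and> t \<in> par w}" for g
  have N_eval: "N (eval_gword W s w) = par w" if "w \<in> ?L" for w
    unfolding N_def using par_eq that by blast
  have word_ex: "\<exists>w\<in>?L. eval_gword W s w = g" if "g \<in> carrier W" for g
    using W.eval_gword_generate[OF sI] gen that by blast
  interpret W: reflection_cocycle W I s N
  proof
    show "N g \<subseteq> carrier W" for g
      using par_sub unfolding N_def by blast
    show "N \<one>\<^bsub>W\<^esub> = {}"
      using N_eval[of "[]"] by (simp add: eval_Nil par_def)
    show "t \<in> N (s i \<otimes>\<^bsub>W\<^esub> h) \<longleftrightarrow> (t = s i) \<noteq> (s i \<otimes>\<^bsub>W\<^esub> t \<otimes>\<^bsub>W\<^esub> s i \<in> N h)"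
      if i: "i \<in> I" and h: "h \<in> carrier W" and t: "t \<in> carrier W" for i h t
    proof -
      obtain w where w: "w \<in> ?L" "eval_gword W s w = h"
        using word_ex h by blast
      then have "N (s i \<otimes>\<^bsub>W\<^esub> h) = par ((i, True) # w)"
        using N_eval[of "(i, True) # w"] i by (simp add: eval_True)
      then show ?thesis
        using N_eval[OF w(1)] w t by (simp add: par_def F)
    qed
  qed (use gen in simp_all)
  show ?thesis
    unfolding I_def[symmetric]
  proof (rule W.strong_hull_property_cayley)

    \<comment> \<open>Infinite order of products of non-commuting generators\<close>
    fix i j n
    assume ij: "i \<in> I" "j \<in> I" and noncomm: "s i \<otimes>\<^bsub>W\<^esub> s j \<noteq> s j \<otimes>\<^bsub>W\<^esub> s i" and n: "n > (0::nat)"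
    have "i \<noteq> j" using noncomm by blast
    have not2: "m i j \<noteq> 2" "m j i \<noteq> 2" using noncomm comm ij by metis+
    let ?w = "concat (replicate n [(i, True), (j, True)])"
    \<comment> \<open>The remaining generators are sent to the identity, which respects the relators because all
      finite off-diagonal entries of a right-angled matrix are \<open>2\<close>.\<close>
    define H where "H = (\<lambda>(k::nat, e::bool) x::int. if k = i then - x else if k = j then 1 - x else x)"
    have eval: "eval_gword W s (concat (replicate k [(i, True), (j, True)])) = (s i \<otimes>\<^bsub>W\<^esub> s j) [^]\<^bsub>W\<^esub> k"
      for k
    proof (induction k)
      case (Suc k)
      then show ?case
        using ij W.nat_pow_Suc2[of "s i \<otimes>\<^bsub>W\<^esub> s j" k] by (simp add: eval_True)
    qed (simp add: eval_Nil)
    \<comment> \<open>The letters \<open>i\<close> and \<open>j\<close> act on the integers as the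
      reflections \<open>x\<close> to \<open>- x\<close> and \<open>x\<close> to
      \<open>1 - x\<close>, so their product is the translation by \<open>- 1\<close>.\<close>
    have fold_H: "foldr H (concat (replicate k [(i, True), (j, True)])) 0 = - int k" for k
      using \<open>i \<noteq> j\<close> by (induction k) (simp_all add: H_def)
    have wL: "?w \<in> ?L" using ij by (induction n) auto
    show "(s i \<otimes>\<^bsub>W\<^esub> s j) [^]\<^bsub>W\<^esub> n \<noteq> \<one>\<^bsub>W\<^esub>"
    proof
      assume "(s i \<otimes>\<^bsub>W\<^esub> s j) [^]\<^bsub>W\<^esub> n = \<one>\<^bsub>W\<^esub>"
      then have equiv: "pres_equiv I ?R ?w []"
        using eval_iff[OF wL, of "[]"] by (simp add: eval eval_Nil)
      have "foldr H ?w 0 = foldr H [] 0"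
      proof (rule pres_equiv_foldr[OF _ _ _ _ RL equiv wL, where Z = UNIV])
        \<comment> \<open>A commutation relator between \<open>i\<close> and \<open>j\<close> would
          act as a translation by two; \<open>not2\<close> excludes it.\<close>
        show "foldr H w z = z" if "w \<in> ?R" for w z
          by (rule relator_cases[OF that])
            (use not2 in \<open>auto simp: H_def\<close>)
      qed (auto simp: H_def)
      then show False using fold_H[of n] n by simp
    qed
  qed
qed

end
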